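(* Let $(A,N)$ be a Nijenhuis algebra. Every free left $(A,N)$-module is a projective left $(A,N)$-module.
   Context: Throughout, $\mathbf{k}$ is a commutative ring with unit; all modules, algebras and linear maps are over $\mathbf{k}$; algebras are associative with unit and modules are unital. A Nijenhuis algebra $(A,N)$ is an algebra $A$ with a linear map $N:A\to A$ such that $N(a)N(b)=N\big(N(a)b+aN(b)-N(ab)\big)$ for all $a,b\in A$. A left $(A,N)$-module $(M,N_M)$ is a left $A$-module $M$ with a linear map $N_M:M\to M$ such that $N(a)N_M(m)=N_M\big(N(a)m+aN_M(m)-N_M(am)\big)$ for all $a\in A$, $m\in M$. A left $(A,N)$-module homomorphism $(M,N_M)\to(M',N_{M'})$ is a left $A$-module homomorphism $f:M\to M'$ with $f\circ N_M=N_{M'}\circ f$. A free left $(A,N)$-module generated by a set $X$ is a left $(A,N)$-module $(F(X),N_{F(X)})$ together with a set map $j:X\to F(X)$ such that for any left $(A,N)$-module $(M,N_M)$ and any set map $f:X\to M$ there is a unique left $(A,N)$-module homomorphism $\widetilde f:F(X)\to M$ with $\widetilde f\circ j=f$. A left $(A,N)$-module $(P,N_P)$ is projective if for every left $(A,N)$-module epimorphism (surjective homomorphism) $f:(M,N_M)\to(M',N_{M'})$ and every left $(A,N)$-module homomorphism $g:(P,N_P)\to(M',N_{M'})$ there exists a left $(A,N)$-module homomorphism $\overline g:(P,N_P)\to(M,N_M)$ with $f\circ\overline g=g$. *)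

theory Defs
  imports "HOL-Algebra.Module"
begin

text \<open>
  The locale \<^locale>\<open>algebra\<close> of HOL-Algebra is commutative; here the product of
  \<open>A\<close> is only assumed to be associative with unit.
\<close>

locale assoc_algebra = module R A + A?: ring A for R (structure) and A (structure) +
  assumes smult_mult_left:
      "\<lbrakk>c \<in> carrier R; a \<in> carrier A; b \<in> carrier A\<rbrakk> \<Longrightarrow>
        (c \<odot>\<^bsub>A\<^esub> a) \<otimes>\<^bsub>A\<^esub> b = c \<odot>\<^bsub>A\<^esub> (a \<otimes>\<^bsub>A\<^esub> b)"
    and smult_mult_right:
      "\<lbrakk>c \<in> carrier R; a \<in> carrier A; b \<in> carrier A\<rbrakk> \<Longrightarrow>
        a \<otimes>\<^bsub>A\<^esub> (c \<odot>\<^bsub>A\<^esub> b) = c \<odot>\<^bsub>A\<^esub> (a \<otimes>\<^bsub>A\<^esub> b)"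

definition linear_maps ::
  "('k, 'r) ring_scheme \<Rightarrow> ('k, 'm, 's) module_scheme \<Rightarrow> ('k, 'n, 't) module_scheme \<Rightarrow> ('m \<Rightarrow> 'n) set"
  where
  "linear_maps R M M' =
    {f \<in> carrier M \<rightarrow> carrier M'.
      (\<forall>x\<in>carrier M. \<forall>y\<in>carrier M. f (x \<oplus>\<^bsub>M\<^esub> y) = f x \<oplus>\<^bsub>M'\<^esub> f y) \<and>
      (\<forall>c\<in>carrier R. \<forall>x\<in>carrier M. f (c \<odot>\<^bsub>M\<^esub> x) = c \<odot>\<^bsub>M'\<^esub> f x)}"

locale nijenhuis_algebra = assoc_algebra R A for R (structure) and A (structure) +
  fixes N :: "'b \<Rightarrow> 'b"
  assumes N_linear: "N \<in> linear_maps R A A"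
    and N_nijenhuis:
      "\<lbrakk>a \<in> carrier A; b \<in> carrier A\<rbrakk> \<Longrightarrow>
        N a \<otimes>\<^bsub>A\<^esub> N b = N (N a \<otimes>\<^bsub>A\<^esub> b \<oplus>\<^bsub>A\<^esub> a \<otimes>\<^bsub>A\<^esub> N b \<ominus>\<^bsub>A\<^esub> N (a \<otimes>\<^bsub>A\<^esub> b))"

text \<open>
  A left \<open>A\<close>-module is an \<open>R\<close>-module with a further operation, the action of \<open>A\<close>.
  As for every HOL-Algebra module, the multiplication and unit fields inherited from
  the ring record carry no meaning.
\<close>

record ('k, 'a, 'm) left_module = "('k, 'm) module" +
  act :: "'a \<Rightarrow> 'm \<Rightarrow> 'm" (infixl \<open>\<rhd>\<index>\<close> 70)

locale algebra_left_module =
  A?: assoc_algebra R A + M?: module R M for R (structure) and A (structure) and M (structure) +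
  assumes act_closed: "\<lbrakk>a \<in> carrier A; m \<in> carrier M\<rbrakk> \<Longrightarrow> a \<rhd>\<^bsub>M\<^esub> m \<in> carrier M"
    and act_add_left:
      "\<lbrakk>a \<in> carrier A; b \<in> carrier A; m \<in> carrier M\<rbrakk> \<Longrightarrow>
        (a \<oplus>\<^bsub>A\<^esub> b) \<rhd>\<^bsub>M\<^esub> m = a \<rhd>\<^bsub>M\<^esub> m \<oplus>\<^bsub>M\<^esub> b \<rhd>\<^bsub>M\<^esub> m"
    and act_add_right:
      "\<lbrakk>a \<in> carrier A; m \<in> carrier M; n \<in> carrier M\<rbrakk> \<Longrightarrow>
        a \<rhd>\<^bsub>M\<^esub> (m \<oplus>\<^bsub>M\<^esub> n) = a \<rhd>\<^bsub>M\<^esub> m \<oplus>\<^bsub>M\<^esub> a \<rhd>\<^bsub>M\<^esub> n"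
    and act_smult_left:
      "\<lbrakk>c \<in> carrier R; a \<in> carrier A; m \<in> carrier M\<rbrakk> \<Longrightarrow>
        (c \<odot>\<^bsub>A\<^esub> a) \<rhd>\<^bsub>M\<^esub> m = c \<odot>\<^bsub>M\<^esub> (a \<rhd>\<^bsub>M\<^esub> m)"
    and act_smult_right:
      "\<lbrakk>c \<in> carrier R; a \<in> carrier A; m \<in> carrier M\<rbrakk> \<Longrightarrow>
        a \<rhd>\<^bsub>M\<^esub> (c \<odot>\<^bsub>M\<^esub> m) = c \<odot>\<^bsub>M\<^esub> (a \<rhd>\<^bsub>M\<^esub> m)"
    and act_mult:
      "\<lbrakk>a \<in> carrier A; b \<in> carrier A; m \<in> carrier M\<rbrakk> \<Longrightarrow>
        (a \<otimes>\<^bsub>A\<^esub> b) \<rhd>\<^bsub>M\<^esub> m = a \<rhd>\<^bsub>M\<^esub> (b \<rhd>\<^bsub>M\<^esub> m)"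
    and act_one: "m \<in> carrier M \<Longrightarrow> \<one>\<^bsub>A\<^esub> \<rhd>\<^bsub>M\<^esub> m = m"

locale nijenhuis_left_module =
  nijenhuis_algebra R A N + algebra_left_module R A M
  for R (structure) and A (structure) and N and M (structure) +
  fixes N\<^sub>M :: "'d \<Rightarrow> 'd"
  assumes NM_linear: "N\<^sub>M \<in> linear_maps R M M"
    and NM_nijenhuis:
      "\<lbrakk>a \<in> carrier A; m \<in> carrier M\<rbrakk> \<Longrightarrow>
        N a \<rhd>\<^bsub>M\<^esub> N\<^sub>M m = N\<^sub>M (N a \<rhd>\<^bsub>M\<^esub> m \<oplus>\<^bsub>M\<^esub> a \<rhd>\<^bsub>M\<^esub> N\<^sub>M m \<ominus>\<^bsub>M\<^esub> N\<^sub>M (a \<rhd>\<^bsub>M\<^esub> m))"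

definition nijenhuis_module_homs ::
  "'k ring \<Rightarrow> ('k, 'a) module \<Rightarrow> ('k, 'a, 'm) left_module \<Rightarrow> ('m \<Rightarrow> 'm) \<Rightarrow>
    ('k, 'a, 'n) left_module \<Rightarrow> ('n \<Rightarrow> 'n) \<Rightarrow> ('m \<Rightarrow> 'n) set"
  where
  "nijenhuis_module_homs R A M N\<^sub>M M' N\<^sub>M' =
    {f \<in> linear_maps R M M'.
      (\<forall>a\<in>carrier A. \<forall>m\<in>carrier M. f (a \<rhd>\<^bsub>M\<^esub> m) = a \<rhd>\<^bsub>M'\<^esub> f m) \<and>
      (\<forall>m\<in>carrier M. f (N\<^sub>M m) = N\<^sub>M' (f m))}"

text \<open>
  HOL cannot quantify over types inside a formula, so the two universal properties below
  take the type \<open>'u\<close> that holds the carriers of the test modules as a parameter.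
  The test modules are all modules whose carrier is some subset of \<open>'u\<close>, and \<open>'u\<close> is
  unrelated to the types of \<open>X\<close> and of the module under consideration. Modules with
  carriers in different types are covered by taking a sum type for \<open>'u\<close>.

  Homomorphisms are total functions of which only the values on the carrier matter; the
  uniqueness in freeness is therefore stated for extensional ones.
\<close>

definition free_nijenhuis_module ::
  "'u itself \<Rightarrow> 'k ring \<Rightarrow> ('k, 'a) module \<Rightarrow> ('a \<Rightarrow> 'a) \<Rightarrow> 'x set \<Rightarrow>
    ('k, 'a, 'f) left_module \<Rightarrow> ('f \<Rightarrow> 'f) \<Rightarrow> ('x \<Rightarrow> 'f) \<Rightarrow> bool"
  where
  "free_nijenhuis_module (_ :: 'u itself) R A N X F N\<^sub>F j \<longleftrightarrow>
    nijenhuis_left_module R A N F N\<^sub>F \<and> j \<in> X \<rightarrow> carrier F \<and>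
    (\<forall>(M :: ('k, 'a, 'u) left_module) N\<^sub>M. nijenhuis_left_module R A N M N\<^sub>M \<longrightarrow>
      (\<forall>f \<in> X \<rightarrow> carrier M.
        \<exists>!h. h \<in> nijenhuis_module_homs R A F N\<^sub>F M N\<^sub>M \<inter> extensional (carrier F) \<and>
             (\<forall>x\<in>X. h (j x) = f x)))"

definition projective_nijenhuis_module ::
  "'u itself \<Rightarrow> 'k ring \<Rightarrow> ('k, 'a) module \<Rightarrow> ('a \<Rightarrow> 'a) \<Rightarrow>
    ('k, 'a, 'p) left_module \<Rightarrow> ('p \<Rightarrow> 'p) \<Rightarrow> bool"
  where
  "projective_nijenhuis_module (_ :: 'u itself) R A N P N\<^sub>P \<longleftrightarrow>
    nijenhuis_left_module R A N P N\<^sub>P \<and>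
    (\<forall>(M :: ('k, 'a, 'u) left_module) N\<^sub>M (M' :: ('k, 'a, 'u) left_module) N\<^sub>M'.
      nijenhuis_left_module R A N M N\<^sub>M \<longrightarrow> nijenhuis_left_module R A N M' N\<^sub>M' \<longrightarrow>
      (\<forall>f \<in> nijenhuis_module_homs R A M N\<^sub>M M' N\<^sub>M'. f ` carrier M = carrier M' \<longrightarrow>
        (\<forall>g \<in> nijenhuis_module_homs R A P N\<^sub>P M' N\<^sub>M'.
          \<exists>h \<in> nijenhuis_module_homs R A P N\<^sub>P M N\<^sub>M. \<forall>p\<in>carrier P. f (h p) = g p)))"

end

theory Submission
  imports Defs
begin

text \<open>
  This is the usual argument that free objects are projective. Let \<open>f\<close> be an epimorphism from
  \<open>M\<close> to \<open>M'\<close> and \<open>g\<close> a homomorphism from the free module \<open>F\<close> to \<open>M'\<close>. Choose, for each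
  generator, a preimage under \<open>f\<close> of its image under \<open>g\<close>; by freeness this choice extends to
  a homomorphism \<open>h\<close> from \<open>F\<close> to \<open>M\<close>. Then \<open>f \<circ> h\<close> and \<open>g\<close> are homomorphisms that agree on
  the generators, so the uniqueness part of freeness, applied to \<open>M'\<close>, identifies them
  (\<open>free_nijenhuis_module_hom_eqI\<close>). That uniqueness speaks of extensional functions, which
  makes it necessary to know that cutting a homomorphism down to the carrier of its domain
  leaves it a homomorphism (\<open>nijenhuis_module_homs_restrict\<close>).
\<close>

lemma nijenhuis_module_homs_compose:
  assumes "h \<in> nijenhuis_module_homs R A L N\<^sub>L M N\<^sub>M"
    and "f \<in> nijenhuis_module_homs R A M N\<^sub>M M' N\<^sub>M'"
  shows "f \<circ> h \<in> nijenhuis_module_homs R A L N\<^sub>L M' N\<^sub>M'"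
  using assms by (simp add: nijenhuis_module_homs_def linear_maps_def Pi_iff)

text \<open>
  All operations of the domain keep its carrier invariant, so the homomorphism equations
  only ever evaluate the map at points of the carrier.
\<close>

lemma nijenhuis_module_homs_restrict:
  assumes "nijenhuis_left_module R A N M N\<^sub>M"
    and "f \<in> nijenhuis_module_homs R A M N\<^sub>M M' N\<^sub>M'"
  shows "restrict f (carrier M) \<in> nijenhuis_module_homs R A M N\<^sub>M M' N\<^sub>M'"
proof -
  interpret nijenhuis_left_module R A N M N\<^sub>M by fact
  have "N\<^sub>M m \<in> carrier M" if "m \<in> carrier M" for m
    using NM_linear that by (auto simp: linear_maps_def)
  then show ?thesis
    using assms(2) by (simp add: nijenhuis_module_homs_def linear_maps_def Pi_iff act_closed)
qed

lemma free_nijenhuis_module_hom_eqI: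
  fixes M :: "('k, 'a, 'u) left_module"
  assumes free: "free_nijenhuis_module TYPE('u) R A N X F N\<^sub>F j"
    and M: "nijenhuis_left_module R A N M N\<^sub>M"
    and f: "f \<in> nijenhuis_module_homs R A F N\<^sub>F M N\<^sub>M"
    and g: "g \<in> nijenhuis_module_homs R A F N\<^sub>F M N\<^sub>M"
    and eq: "\<And>x. x \<in> X \<Longrightarrow> f (j x) = g (j x)"
    and p: "p \<in> carrier F"
  shows "f p = g p"
proof -
  have F: "nijenhuis_left_module R A N F N\<^sub>F" and j: "j \<in> X \<rightarrow> carrier F"
    using free by (auto simp: free_nijenhuis_module_def)
  have "(\<lambda>x. g (j x)) \<in> X \<rightarrow> carrier M"
    using g j by (auto simp: nijenhuis_module_homs_def linear_maps_def)
  moreover define extends where "extends = (\<lambda>h.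
      h \<in> nijenhuis_module_homs R A F N\<^sub>F M N\<^sub>M \<inter> extensional (carrier F) \<and>
      (\<forall>x\<in>X. h (j x) = g (j x)))"
  ultimately have "\<exists>!h. extends h"
    using free M unfolding free_nijenhuis_module_def by simp
  moreover have "extends (restrict f (carrier F))"
    using nijenhuis_module_homs_restrict[OF F f] j eq unfolding extends_def by auto
  moreover have "extends (restrict g (carrier F))"
    using nijenhuis_module_homs_restrict[OF F g] j unfolding extends_def by auto
  ultimately have "restrict f (carrier F) = restrict g (carrier F)"
    by blast
  then show ?thesis
    using p by (metis restrict_apply')
qed

theorem proposition4p2:
  fixes R :: "'k ring" and A :: "('k, 'a) module" and N :: "'a \<Rightarrow> 'a"
    and X :: "'x set" and F :: "('k, 'a, 'f) left_module" and N\<^sub>F :: "'f \<Rightarrow> 'f"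
    and j :: "'x \<Rightarrow> 'f"
  assumes "nijenhuis_algebra R A N"
    and "free_nijenhuis_module TYPE('u) R A N X F N\<^sub>F j"
  shows "projective_nijenhuis_module TYPE('u) R A N F N\<^sub>F"
proof -
  have F: "nijenhuis_left_module R A N F N\<^sub>F" and j: "j \<in> X \<rightarrow> carrier F"
    using assms(2) by (auto simp: free_nijenhuis_module_def)
  have "\<exists>h \<in> nijenhuis_module_homs R A F N\<^sub>F M N\<^sub>M. \<forall>p\<in>carrier F. f (h p) = g p"
    if M: "nijenhuis_left_module R A N M N\<^sub>M"
      and M': "nijenhuis_left_module R A N M' N\<^sub>M'"
      and f: "f \<in> nijenhuis_module_homs R A M N\<^sub>M M' N\<^sub>M'"
      and surj: "f ` carrier M = carrier M'"
      and g: "g \<in> nijenhuis_module_homs R A F N\<^sub>F M' N\<^sub>M'"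
    for M :: "('k, 'a, 'u) left_module" and N\<^sub>M
      and M' :: "('k, 'a, 'u) left_module" and N\<^sub>M' f g
  proof -
    have "\<forall>x\<in>X. g (j x) \<in> f ` carrier M"
      using g j surj by (auto simp: nijenhuis_module_homs_def linear_maps_def)
    then have "\<forall>x\<in>X. \<exists>m. m \<in> carrier M \<and> f m = g (j x)"
      by (metis imageE)
    from bchoice[OF this] obtain s where s: "\<forall>x\<in>X. s x \<in> carrier M \<and> f (s x) = g (j x)"
      by blast
    then have "s \<in> X \<rightarrow> carrier M"
      by auto
    then have "\<exists>!h. h \<in> nijenhuis_module_homs R A F N\<^sub>F M N\<^sub>M \<inter> extensional (carrier F) \<and>
        (\<forall>x\<in>X. h (j x) = s x)"
      using assms(2) M by (simp add: free_nijenhuis_module_def)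
    then obtain h where h: "h \<in> nijenhuis_module_homs R A F N\<^sub>F M N\<^sub>M"
      and hj: "\<And>x. x \<in> X \<Longrightarrow> h (j x) = s x"
      by blast
    have "(f \<circ> h) p = g p" if "p \<in> carrier F" for p
      using assms(2) M' nijenhuis_module_homs_compose[OF h f] g _ that
      by (rule free_nijenhuis_module_hom_eqI) (simp add: hj s)
    with h show ?thesis
      by auto
  qed
  with F show ?thesis
    unfolding projective_nijenhuis_module_def by (intro conjI allI impI ballI)
qed

end
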